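(* Let $n,m\ge1$, let $\mathcal{X}\subset\mathbb{R}^n$ be nonempty, compact and convex, and let $g=(g_1,\dots,g_m)^T:\mathbb{R}^n\to\mathbb{R}^m$ have convex $C^2$ components. Let $b=(b_1,\dots,b_n)$ be non-negative reals, $B=\max_{1\le i\le n}b_i$, $\epsilon>0$ and $\delta\in(0,1)$. Fix $i\in\{1,\dots,n\}$ and let $K^i_{g'}$ be the Lipschitz constant of $\frac{\partial g}{\partial x_i}:\mathcal{X}\to\mathbb{R}^m$ over $\mathcal{X}$ (Euclidean norms). Then the mechanism $$(M^i_{g'}x)(k)=\frac{\partial g}{\partial x_i}\big(x(k)\big)+w_i(k),\qquad k\ge0,$$ where the $w_i(k)\sim\mathcal{N}(0,\sigma_i^2I_m)$ are independent over $k$ and $$\sigma_i\ge\kappa(\delta,\epsilon)\,K^i_{g'}\,B,$$ is $(\epsilon,\delta)$-differentially private with respect to the adjacency relation $\mathrm{Adj}_b$ on $\mathcal{X}$-valued signals.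
   Context: The Lipschitz constant of a map is its smallest Lipschitz constant. $\mathcal{N}(0,\sigma^2I_m)$ with $\sigma=0$ is the point mass at $0$. $\mathcal{Q}(x)=\frac{1}{\sqrt{2\pi}}\int_x^\infty e^{-u^2/2}\,du$, $K_\delta=\mathcal{Q}^{-1}(\delta)$, and $\kappa(\delta,\epsilon)=\frac{1}{2\epsilon}\left(K_\delta+\sqrt{K_\delta^2+2\epsilon}\right)$. Input signals are (deterministic) sequences $x=(x(0),x(1),\dots)$ with $x(k)=(x_1(k),\dots,x_n(k))^T\in\mathcal{X}$; the $j$-th component signal is $x_j=(x_j(k))_{k\ge0}$. Adjacency: $\mathrm{Adj}_b(x,\tilde x)$ holds if and only if there is an index $l$ such that $\|x_l-\tilde x_l\|_2=\left(\sum_{k\ge0}|x_l(k)-\tilde x_l(k)|^2\right)^{1/2}\le b_l$ and $x_j=\tilde x_j$ for all $j\ne l$. A mechanism $M$ is a map sending each input signal $x$ to a random sequence $Mx$ in $\mathbb{R}^m$. Write $(Mx)_{0:k}=((Mx)(0)^T,\dots,(Mx)(k)^T)^T\in\mathbb{R}^{(k+1)m}$. $M$ is $(\epsilon,\delta)$-differentially private if for all input signals $x,\tilde x$ with $\mathrm{Adj}_b(x,\tilde x)$, $$\mathbb{P}\big((Mx)_{0:k}\in S\big)\le e^{\epsilon}\,\mathbb{P}\big((M\tilde x)_{0:k}\in S\big)+\delta\quad\text{for all }k\ge0\text{ and all Borel }S\subseteq\mathbb{R}^{(k+1)m}.$$ *)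

theory Defs
  imports "HOL-Probability.Probability"
begin

definition gauss_Q :: "real \<Rightarrow> real" where
  "gauss_Q x = 1 / sqrt (2 * pi) * (LINT u:{x..}|lborel. exp (- (u\<^sup>2 / 2)))"

text \<open>\<^term>\<open>gauss_Q\<close> is a strictly decreasing bijection from the reals onto the open interval
  from 0 to 1, so the inverse below is meaningful exactly for arguments in that interval.\<close>

definition gauss_K :: "real \<Rightarrow> real" where
  "gauss_K \<delta> = inv gauss_Q \<delta>"

definition kappa :: "real \<Rightarrow> real \<Rightarrow> real" where
  "kappa \<delta> \<epsilon> = 1 / (2 * \<epsilon>) * (gauss_K \<delta> + sqrt ((gauss_K \<delta>)\<^sup>2 + 2 * \<epsilon>))"

text \<open>Law of a centred Gaussian vector with covariance \<open>\<sigma>\<^sup>2\<close> times the identity (for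
  \<open>\<sigma> \<ge> 0\<close>); the parameter is the standard deviation, and \<open>\<sigma> = 0\<close> gives the point mass at 0.\<close>

definition isotropic_normal :: "real \<Rightarrow> (real ^ 'm) measure" where
  "isotropic_normal \<sigma> =
    (if \<sigma> = 0 then return borel 0
     else density lborel (\<lambda>z. ennreal (\<Prod>j\<in>UNIV. normal_density 0 \<sigma> (z $ j))))"

definition twice_cont_differentiable :: "('a::real_normed_vector \<Rightarrow> real) \<Rightarrow> bool" where
  "twice_cont_differentiable f \<longleftrightarrow>
    (\<exists>(f' :: 'a \<Rightarrow> 'a \<Rightarrow>\<^sub>L real) (f'' :: 'a \<Rightarrow> 'a \<Rightarrow>\<^sub>L ('a \<Rightarrow>\<^sub>L real)).
       (\<forall>x. (f has_derivative blinfun_apply (f' x)) (at x)) \<and>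
       (\<forall>x. (f' has_derivative blinfun_apply (f'' x)) (at x)) \<and>
       continuous_on UNIV f'')"

definition partial_derivative :: "(real ^ 'n \<Rightarrow> real ^ 'm) \<Rightarrow> 'n \<Rightarrow> real ^ 'n \<Rightarrow> real ^ 'm" where
  "partial_derivative g i x = vector_derivative (\<lambda>t. g (x + t *\<^sub>R axis i 1)) (at 0)"

text \<open>The smallest Lipschitz constant; \<^const>\<open>lipschitz_on\<close> only admits constants \<open>\<ge> 0\<close>.
  The value is unspecified if the map is not Lipschitz on the set.\<close>

definition lipschitz_constant :: "'a::metric_space set \<Rightarrow> ('a \<Rightarrow> 'b::metric_space) \<Rightarrow> real" where
  "lipschitz_constant X f = (LEAST L. lipschitz_on L X f)"

definition signals :: "'a set \<Rightarrow> (nat \<Rightarrow> 'a) set" where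
  "signals X = {x. \<forall>k. x k \<in> X}"

text \<open>The summability conjunct expresses that the \<open>\<ell>\<^sup>2\<close> distance is finite; without it
  \<^const>\<open>suminf\<close> would not be the value of the series.\<close>

definition Adj :: "('n \<Rightarrow> real) \<Rightarrow> (nat \<Rightarrow> real ^ 'n) \<Rightarrow> (nat \<Rightarrow> real ^ 'n) \<Rightarrow> bool" where
  "Adj b x x' \<longleftrightarrow>
    (\<exists>l. summable (\<lambda>k. \<bar>x k $ l - x' k $ l\<bar>\<^sup>2) \<and>
         sqrt (\<Sum>k. \<bar>x k $ l - x' k $ l\<bar>\<^sup>2) \<le> b l \<and>
         (\<forall>j. j \<noteq> l \<longrightarrow> (\<forall>k. x k $ j = x' k $ j)))"

text \<open>A mechanism on a class of input signals sends each of them to a random sequence, i.e. a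
  sequence of random vectors on the probability space \<open>P\<close>.\<close>

definition mechanism ::
  "'w measure \<Rightarrow> (nat \<Rightarrow> 'a) set \<Rightarrow> ((nat \<Rightarrow> 'a) \<Rightarrow> 'w \<Rightarrow> nat \<Rightarrow> real ^ 'm) \<Rightarrow> bool" where
  "mechanism P D M \<longleftrightarrow>
    prob_space P \<and> (\<forall>x\<in>D. \<forall>k. (\<lambda>\<omega>. M x \<omega> k) \<in> borel_measurable P)"

text \<open>The finite segment with indices \<open>0, \<dots>, k\<close> of a sequence of vectors is represented by its
  restriction to \<^term>\<open>{..k}\<close>; its value space is the \<open>(k+1)\<close>-fold product of the space of vectors,
  and the product sigma algebra is the Borel sigma algebra of that product.\<close>

definition diff_private ::
  "'w measure \<Rightarrow> (nat \<Rightarrow> 'a) set \<Rightarrow> ((nat \<Rightarrow> 'a) \<Rightarrow> (nat \<Rightarrow> 'a) \<Rightarrow> bool) \<Rightarrow> real \<Rightarrow> real \<Rightarrow>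
    ((nat \<Rightarrow> 'a) \<Rightarrow> 'w \<Rightarrow> nat \<Rightarrow> real ^ 'm) \<Rightarrow> bool" where
  "diff_private P D A \<epsilon> \<delta> M \<longleftrightarrow>
    mechanism P D M \<and>
    (\<forall>x\<in>D. \<forall>x'\<in>D. A x x' \<longrightarrow>
      (\<forall>k. \<forall>S\<in>sets (PiM {..k} (\<lambda>_. borel)).
         measure P {\<omega> \<in> space P. restrict (M x \<omega>) {..k} \<in> S}
           \<le> exp \<epsilon> * measure P {\<omega> \<in> space P. restrict (M x' \<omega>) {..k} \<in> S} + \<delta>))"

end

theory Submission
  imports Defs
begin

text \<open>
  Adding Gaussian noise to a vector statistic is private because two Gaussian laws with the same
  covariance and different centres have comparable densities outside a half space. Suppose that
  for two adjacent inputs the statistic of the first \<open>k + 1\<close> samples is \<open>u\<close> and \<open>u'\<close>, put \<open>\<Delta>\<close>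
  for the distance of \<open>u\<close> and \<open>u'\<close>, and let \<open>w\<close> be the noise. At the point \<open>u + w\<close> the logarithm
  of the ratio of the density centred at \<open>u\<close> to the one centred at \<open>u'\<close> is
  \<open>(\<Delta>\<^sup>2 + 2 (u - u') \<bullet> w) / (2 \<sigma>\<^sup>2)\<close>. Where it is at most \<open>\<epsilon>\<close>, the first law is at most
  \<open>exp \<epsilon>\<close> times the second. The remaining event costs its probability under the first law. Since
  \<open>(u - u') \<bullet> w\<close> is a centred real Gaussian of standard deviation \<open>\<sigma> \<Delta>\<close>, that cost is
  \<open>Q (\<epsilon> s - 1 / (2 s))\<close> with \<open>s = \<sigma> / \<Delta>\<close>. The number \<open>kappa \<delta> \<epsilon>\<close> is the
  positive root of \<open>\<epsilon> s - 1 / (2 s) = K\<close> for \<open>K = gauss_K \<delta>\<close>, so \<open>s \<ge> kappa \<delta> \<epsilon>\<close> bounds the cost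
  by \<open>Q K = \<delta>\<close>. This is the content of \<open>gaussian_mechanism\<close> and \<open>kappa_le_imp_gauss_K_le\<close>.

  What remains is \<open>\<Delta> \<le> L B\<close>, where \<open>L\<close> is the Lipschitz constant of the partial derivative.
  Adjacent signals differ in one component only, so the Euclidean distance of their samples is the
  distance in that component, and summing the squared Lipschitz estimates over time gives the bound
  (\<open>Adj_lipschitz_sensitivity\<close>). The constant exists because the second derivative of \<open>g\<close> is
  bounded on the compact convex set \<open>X\<close>, and it is attained because the Lipschitz inequalities
  survive passing to the infimum of the admissible constants. If \<open>\<Delta> = 0\<close>, which is forced when
  \<open>\<sigma> = 0\<close>, the two outputs agree on the segment considered and there is nothing to compare.
\<close>

section \<open>The Gaussian tail function and its inverse\<close>

lemma gauss_Q_eq_measure: "gauss_Q x = measure std_normal_distribution {x..}"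
proof -
  have "measure std_normal_distribution {x..} = (LINT u|std_normal_distribution. indicator {x..} u)"
    by simp
  also have "\<dots> = (LINT u|lborel. std_normal_density u * indicator {x..} u)"
    by (subst integral_density) auto
  also have "\<dots> = (LINT u|lborel. 1 / sqrt (2 * pi) * (indicator {x..} u * exp (- (u\<^sup>2 / 2))))"
    by (intro Bochner_Integration.integral_cong) (auto simp: std_normal_density_def)
  also have "\<dots> = gauss_Q x"
    by (simp only: integral_mult_right_zero gauss_Q_def set_lebesgue_integral_def real_scaleR_def)
  finally show ?thesis by simp
qed

lemma gauss_Q_eq_cdf: "gauss_Q x = 1 - cdf std_normal_distribution x"
  and isCont_cdf_std_normal: "isCont (cdf std_normal_distribution) x"
proof -
  interpret N: real_distribution std_normal_distribution
    by (rule real_dist_normal_dist)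
  have "emeasure std_normal_distribution {x} = 0"
    by (subst emeasure_density)
       (auto intro!: nn_integral_0_iff_AE[THEN iffD2] AE_mp[OF AE_lborel_singleton[of x]])
  then have pt: "measure std_normal_distribution {x} = 0"
    by (simp add: measure_def)
  then show "isCont (cdf std_normal_distribution) x"
    by (simp add: N.isCont_cdf)
  have "measure std_normal_distribution (UNIV - {..<x}) = 1 - measure std_normal_distribution {..<x}"
    using N.prob_compl[of "{..<x}"] by simp
  moreover have "UNIV - {..<x} = {x..}" by auto
  moreover have "measure std_normal_distribution ({..<x} \<union> {x}) 
     = measure std_normal_distribution {..<x} + measure std_normal_distribution {x}"
    by (intro N.finite_measure_Union) auto
  moreover have "{..<x} \<union> {x} = {..x}" by auto
  ultimately show "gauss_Q x = 1 - cdf std_normal_distribution x"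
    using pt by (simp add: gauss_Q_eq_measure cdf_def)
qed

lemma gauss_Q_antimono: "x \<le> y \<Longrightarrow> gauss_Q y \<le> gauss_Q x"
proof -
  interpret N: real_distribution std_normal_distribution
    by (rule real_dist_normal_dist)
  show "x \<le> y \<Longrightarrow> gauss_Q y \<le> gauss_Q x"
    by (simp add: gauss_Q_eq_cdf N.cdf_nondecreasing)
qed

text \<open>An inverse of \<^const>\<open>gauss_Q\<close> is a right inverse at every value that is taken, so it suffices
  that \<open>\<delta>\<close> is taken; this is the intermediate value theorem for the distribution function.\<close>
lemma gauss_Q_gauss_K:
  assumes "0 < \<delta>" "\<delta> < 1"
  shows "gauss_Q (gauss_K \<delta>) = \<delta>"
proof -
  interpret N: real_distribution std_normal_distribution
    by (rule real_dist_normal_dist)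
  let ?F = "cdf std_normal_distribution"
  have "\<forall>\<^sub>F x in at_bot. ?F x < 1 - \<delta>"
    using N.cdf_lim_at_bot assms by (intro order_tendstoD(2)[of _ 0]) auto
  then obtain a where a: "\<And>x. x \<le> a \<Longrightarrow> ?F x < 1 - \<delta>"
    by (auto simp: eventually_at_bot_linorder)
  have "\<forall>\<^sub>F x in at_top. ?F x > 1 - \<delta>"
    using N.cdf_lim_at_top_prob assms by (intro order_tendstoD(1)[of _ 1]) auto
  then obtain c where c: "\<And>x. x \<ge> c \<Longrightarrow> ?F x > 1 - \<delta>"
    by (auto simp: eventually_at_top_linorder)
  have "\<exists>x\<ge>min a c. x \<le> max a c \<and> ?F x = 1 - \<delta>"
    using a[of "min a c"] c[of "max a c"] isCont_cdf_std_normal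
    by (intro IVT) (auto intro: less_imp_le)
  then obtain x where "?F x = 1 - \<delta>" by blast
  then have "gauss_Q x = \<delta>"
    by (simp add: gauss_Q_eq_cdf)
  then show ?thesis
    unfolding gauss_K_def by (metis f_inv_into_f rangeI)
qed

lemma kappa_pos: "0 < \<epsilon> \<Longrightarrow> 0 < kappa \<delta> \<epsilon>"
proof -
  assume e: "0 < \<epsilon>"
  have "\<bar>gauss_K \<delta>\<bar> < sqrt ((gauss_K \<delta>)\<^sup>2 + 2 * \<epsilon>)"
    using e by (intro real_less_rsqrt) auto
  then show ?thesis using e by (auto simp: kappa_def intro!: divide_pos_pos)
qed

text \<open>The right-hand side increases with \<open>s > 0\<close> and equals \<^term>\<open>gauss_K \<delta>\<close> at
  \<open>s = kappa \<delta> \<epsilon>\<close>: clearing denominators gives \<open>2 \<epsilon> s\<^sup>2 - 2 K s - 1 \<ge> 0\<close>, whose larger root is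
  \<^const>\<open>kappa\<close>. The proof squares \<open>sqrt (K\<^sup>2 + 2 \<epsilon>) \<le> 2 \<epsilon> s - K\<close>.\<close>
lemma kappa_le_imp_gauss_K_le:
  assumes e: "0 < \<epsilon>" and s: "kappa \<delta> \<epsilon> \<le> s"
  shows "gauss_K \<delta> \<le> \<epsilon> * s - 1 / (2 * s)"
proof -
  define K where "K = gauss_K \<delta>"
  define r where "r = sqrt (K\<^sup>2 + 2 * \<epsilon>)"
  have r: "r\<^sup>2 = K\<^sup>2 + 2 * \<epsilon>" "r > 0"
    using e by (auto simp: r_def add_nonneg_pos)
  have pos: "s > 0" using kappa_pos[OF e, of \<delta>] s by linarith
  have h: "r \<le> 2 * \<epsilon> * s - K"
    using s e unfolding kappa_def K_def[symmetric] r_def[symmetric]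
    by (simp add: pos_divide_le_eq algebra_simps)
  have "r\<^sup>2 \<le> (2 * \<epsilon> * s - K)\<^sup>2"
    using h r by (intro power_mono) auto
  then have "2 * \<epsilon> * 1 \<le> 2 * \<epsilon> * (2 * \<epsilon> * s\<^sup>2 - 2 * K * s)"
    unfolding r(1) by (simp add: power2_eq_square algebra_simps)
  then have "1 \<le> 2 * \<epsilon> * s\<^sup>2 - 2 * K * s"
    using e by (subst (asm) mult_le_cancel_left_pos) auto
  then show ?thesis
    using pos by (simp add: K_def[symmetric] field_simps power2_eq_square)
qed

section \<open>Densities and products\<close>

text \<open>Off the tail set the integrand \<open>f\<close> is at most \<open>c * g\<close>; on it, all of \<open>f\<close> is paid for. With
  \<open>c = exp \<epsilon>\<close> this turns a bound on the tail into approximate differential privacy.\<close>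
lemma density_measure_le_scaled_plus_tail:
  assumes [measurable]: "f \<in> borel_measurable N" "g \<in> borel_measurable N" "A \<in> sets N"
  shows "emeasure (density N f) A \<le>
    c * emeasure (density N g) A + emeasure (density N f) {x \<in> space N. c * g x < f x}"
proof -
  have "emeasure (density N f) A = (\<integral>\<^sup>+x. f x * indicator A x \<partial>N)"
    by (simp add: emeasure_density)
  also have "\<dots> \<le> (\<integral>\<^sup>+x. c * (g x * indicator A x) +
      f x * indicator {x \<in> space N. c * g x < f x} x \<partial>N)"
    by (intro nn_integral_mono) (auto split: split_indicator simp: not_less add_increasing)
  also have "\<dots> = c * emeasure (density N g) A +
      emeasure (density N f) {x \<in> space N. c * g x < f x}"
    by (subst nn_integral_add) (auto simp: emeasure_density nn_integral_cmult)
  finally show ?thesis .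
qed

text \<open>Both sides are \<open>\<sigma>\<close>-finite, so it is enough that they agree on boxes, where the integral of a
  product over the coordinates factors.\<close>
lemma PiM_density:
  fixes f :: "'i \<Rightarrow> 'a \<Rightarrow> ennreal"
  assumes I: "finite I" and M: "\<And>i. sigma_finite_measure (M i)"
    and f[measurable]: "\<And>i. f i \<in> borel_measurable (M i)"
    and fin: "\<And>i x. f i x \<noteq> \<infinity>"
  shows "PiM I (\<lambda>i. density (M i) (f i)) = density (PiM I M) (\<lambda>x. \<Prod>i\<in>I. f i (x i))"
proof -
  interpret A: product_sigma_finite M using M by (simp add: product_sigma_finite_def)
  interpret B: product_sigma_finite "\<lambda>i. density (M i) (f i)"
    using M fin by (simp add: product_sigma_finite_def sigma_finite_measure.sigma_finite_iff_density_finite)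
  show ?thesis
  proof (rule B.PiM_eqI[OF I, symmetric])
    show "sets (density (PiM I M) (\<lambda>x. \<Prod>i\<in>I. f i (x i))) = sets (PiM I (\<lambda>i. density (M i) (f i)))"
      by (simp cong: sets_PiM_cong)
    fix A assume "\<And>i. i \<in> I \<Longrightarrow> A i \<in> sets (density (M i) (f i))"
    then have A[measurable]: "\<And>i. i \<in> I \<Longrightarrow> A i \<in> sets (M i)" by simp
    have "emeasure (density (PiM I M) (\<lambda>x. \<Prod>i\<in>I. f i (x i))) (Pi\<^sub>E I A) =
      (\<integral>\<^sup>+x. (\<Prod>i\<in>I. f i (x i)) * indicator (Pi\<^sub>E I A) x \<partial>PiM I M)"
      using I A by (subst emeasure_density) (auto intro!: sets_PiM_I_finite)
    also have "\<dots> = (\<integral>\<^sup>+x. (\<Prod>i\<in>I. f i (x i) * indicator (A i) (x i)) \<partial>PiM I M)"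
    proof (intro nn_integral_cong)
      fix x assume "x \<in> space (PiM I M)"
      then have "x \<in> extensional I" by (auto simp: space_PiM PiE_def)
      then have "indicator (Pi\<^sub>E I A) x = (\<Prod>i\<in>I. indicator (A i) (x i) :: ennreal)"
        using I by (auto simp: PiE_def Pi_def indicator_def prod_zero_iff)
      then show "(\<Prod>i\<in>I. f i (x i)) * indicator (Pi\<^sub>E I A) x =
          (\<Prod>i\<in>I. f i (x i) * indicator (A i) (x i))"
        by (simp add: prod.distrib)
    qed
    also have "\<dots> = (\<Prod>i\<in>I. \<integral>\<^sup>+x. f i x * indicator (A i) x \<partial>M i)"
      using I by (intro A.product_nn_integral_prod) auto
    also have "\<dots> = (\<Prod>i\<in>I. emeasure (density (M i) (f i)) (A i))"
      by (intro prod.cong) (auto simp: emeasure_density)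
    finally show "emeasure (density (PiM I M) (\<lambda>x. \<Prod>i\<in>I. f i (x i))) (Pi\<^sub>E I A) =
      (\<Prod>i\<in>I. emeasure (density (M i) (f i)) (A i))" .
  qed
qed

section \<open>Projections of an isotropic Gaussian vector\<close>

text \<open>Degenerate summands are allowed because a direction of projection may vanish in some
  coordinates or at some times, and a normal density of standard deviation 0 does not describe
  the point mass.\<close>
lemma (in prob_space) sum_indep_centred_normal:
  assumes I: "finite I" and ind: "indep_vars (\<lambda>i. borel) X I"
    and s: "\<And>i. i \<in> I \<Longrightarrow> 0 \<le> s i"
    and zero: "\<And>i \<omega>. i \<in> I \<Longrightarrow> s i = 0 \<Longrightarrow> X i \<omega> = 0"
    and normal: "\<And>i. i \<in> I \<Longrightarrow> 0 < s i \<Longrightarrow> distributed M lborel (X i) (normal_density 0 (s i))"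
    and pos: "0 < (\<Sum>i\<in>I. (s i)\<^sup>2)"
  shows "distributed M lborel (\<lambda>\<omega>. \<Sum>i\<in>I. X i \<omega>) (normal_density 0 (sqrt (\<Sum>i\<in>I. (s i)\<^sup>2)))"
proof -
  define J where "J = {i\<in>I. 0 < s i}"
  have J: "finite J" "J \<subseteq> I" using I by (auto simp: J_def)
  have out: "s i = 0" if "i \<in> I - J" for i using that s[of i] by (auto simp: J_def)
  have s2: "(\<Sum>i\<in>I. (s i)\<^sup>2) = (\<Sum>i\<in>J. (s i)\<^sup>2)"
    using out by (intro sum.mono_neutral_right) (auto simp: I J)
  have X: "(\<Sum>i\<in>I. X i \<omega>) = (\<Sum>i\<in>J. X i \<omega>)" for \<omega>
    using out zero by (intro sum.mono_neutral_right) (auto simp: I J)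
  have "J \<noteq> {}" using pos s2 by auto
  then have "distributed M lborel (\<lambda>\<omega>. \<Sum>i\<in>J. X i \<omega>)
      (normal_density (\<Sum>i\<in>J. 0) (sqrt (\<Sum>i\<in>J. (s i)\<^sup>2)))"
    using J normal by (intro sum_indep_normal indep_vars_subset[OF ind]) (auto simp: J_def)
  then show ?thesis by (simp add: s2 X)
qed

text \<open>All three facts come from the mass of a box: Lebesgue measure on a Euclidean space integrates a
  product of functions of the coordinates factor by factor.\<close>
lemma prob_space_isotropic_normal: "0 < \<sigma> \<Longrightarrow> prob_space (isotropic_normal \<sigma> :: (real^'m) measure)"
  and distr_isotropic_normal_nth:
    "0 < \<sigma> \<Longrightarrow> distr (isotropic_normal \<sigma>) borel (\<lambda>z::real^'m. z $ j) = density lborel (normal_density 0 \<sigma>)"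
  and indep_isotropic_normal_nth:
    "0 < \<sigma> \<Longrightarrow> prob_space.indep_vars (isotropic_normal \<sigma>) (\<lambda>_. borel) (\<lambda>j (z::real^'m). z $ j) UNIV"
proof -
  assume s: "0 < \<sigma>"
  let ?N = "isotropic_normal \<sigma> :: (real^'m) measure"
  let ?D = "density lborel (normal_density 0 \<sigma>)"
  interpret D: prob_space ?D by (rule prob_space_normal_density[OF s])
  have bij: "bij_betw (\<lambda>j. axis j (1::real)) (UNIV :: 'm set) Basis"
    by (auto simp: bij_betw_def inj_on_def axis_eq_axis Basis_vec_def)
  have box: "emeasure ?N {z. \<forall>j. z $ j \<in> A j} = (\<Prod>j\<in>UNIV. emeasure ?D (A j))"
    if A[measurable]: "\<And>j. A j \<in> sets borel" for A :: "'m \<Rightarrow> real set"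
  proof -
    define F where "F j t = ennreal (normal_density 0 \<sigma> t) * indicator (A j) t" for j t
    \<comment> \<open>Lebesgue measure is a product over the basis vectors; \<open>h\<close> turns them back into indices.\<close>
    define h where "h = inv_into UNIV (\<lambda>j::'m. axis j (1::real))"
    have h: "h (axis j 1) = j" for j
      using bij unfolding h_def bij_betw_def by (metis UNIV_I inv_into_f_f)
    have [measurable]: "F j \<in> borel_measurable borel" for j unfolding F_def by measurable
    have "emeasure ?N {z. \<forall>j. z $ j \<in> A j} =
        (\<integral>\<^sup>+z. ennreal (\<Prod>j\<in>UNIV. normal_density 0 \<sigma> (z $ j)) * indicator {z. \<forall>j. z $ j \<in> A j} z \<partial>lborel)"
      using s by (simp add: isotropic_normal_def) (subst emeasure_density, auto)
    also have "\<dots> = (\<integral>\<^sup>+z. (\<Prod>j\<in>UNIV. F j (z $ j)) \<partial>lborel)"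
    proof (intro nn_integral_cong)
      fix z :: "real^'m"
      have "indicator {z. \<forall>j. z $ j \<in> A j} z = (\<Prod>j\<in>UNIV. indicator (A j) (z $ j) :: ennreal)"
        by (auto simp: indicator_def prod_zero_iff)
      then show "ennreal (\<Prod>j\<in>UNIV. normal_density 0 \<sigma> (z $ j)) * indicator {z. \<forall>j. z $ j \<in> A j} z
          = (\<Prod>j\<in>UNIV. F j (z $ j))"
        by (simp add: F_def prod.distrib prod_ennreal)
    qed
    also have "\<dots> = (\<integral>\<^sup>+z. (\<Prod>e\<in>Basis. F (h e) (z \<bullet> e)) \<partial>lborel)"
      by (intro nn_integral_cong, subst prod.reindex_bij_betw[OF bij, symmetric])
         (simp add: h inner_axis)
    also have "\<dots> = (\<Prod>e\<in>(Basis::(real^'m) set). \<integral>\<^sup>+t. F (h e) t \<partial>lborel)"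
      by (intro nn_integral_lborel_prod) auto
    also have "\<dots> = (\<Prod>j\<in>UNIV. emeasure ?D (A j))"
      by (subst prod.reindex_bij_betw[OF bij, symmetric])
         (simp add: h F_def[abs_def] emeasure_density)
    finally show ?thesis .
  qed
  have N[simp]: "sets ?N = sets borel" "space ?N = UNIV"
    by (auto simp: isotropic_normal_def)
  have [measurable_cong]: "sets ?N = sets borel" by simp
  show prob: "prob_space ?N"
    using box[of "\<lambda>_. UNIV"] D.emeasure_space_1 by (intro prob_spaceI) simp
  interpret N: prob_space ?N by (rule prob)
  have law: "distr ?N borel (\<lambda>z. z $ j) = ?D" for j
  proof (rule measure_eqI)
    fix A assume "A \<in> sets (distr ?N borel (\<lambda>z. z $ j))"
    then have A[measurable]: "A \<in> sets borel" by simp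
    have "emeasure (distr ?N borel (\<lambda>z. z $ j)) A = emeasure ?N {z. z $ j \<in> A}"
      by (subst emeasure_distr) (auto simp: vimage_def)
    also have "{z. z $ j \<in> A} = {z::real^'m. \<forall>k. z $ k \<in> (if k = j then A else UNIV)}"
      by (auto split: if_splits)
    also have "emeasure ?N \<dots> = (\<Prod>k\<in>UNIV. emeasure ?D (if k = j then A else UNIV))"
      by (rule box) simp
    also have "\<dots> = (\<Prod>k\<in>UNIV. if k = j then emeasure ?D A else 1)"
      using D.emeasure_space_1 by (intro prod.cong) auto
    also have "\<dots> = emeasure ?D A" by simp
    finally show "emeasure (distr ?N borel (\<lambda>z. z $ j)) A = emeasure ?D A" .
  qed simp
  then show "distr ?N borel (\<lambda>z. z $ j) = ?D" .
  interpret P: product_sigma_finite "\<lambda>_::'m. ?D"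
    by (simp add: product_sigma_finite_def D.sigma_finite_measure_axioms)
  have "distr ?N (PiM UNIV (\<lambda>_. borel)) (\<lambda>z. \<lambda>j\<in>UNIV. z $ j) = PiM UNIV (\<lambda>_. ?D)"
  proof (rule P.PiM_eqI)
    fix A :: "'m \<Rightarrow> real set" assume "\<And>i. i \<in> UNIV \<Longrightarrow> A i \<in> sets ?D"
    then have A[measurable]: "\<And>i. A i \<in> sets borel" by simp
    have "Pi\<^sub>E UNIV A \<in> sets (PiM UNIV (\<lambda>_. borel))"
      by (rule sets_PiM_I_finite) auto
    then have "emeasure (distr ?N (PiM UNIV (\<lambda>_. borel)) (\<lambda>z. \<lambda>j\<in>UNIV. z $ j)) (Pi\<^sub>E UNIV A)
       = emeasure ?N {z. \<forall>j. z $ j \<in> A j}"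
      by (subst emeasure_distr) (auto simp: vimage_def PiE_def Pi_def)
    then show "emeasure (distr ?N (PiM UNIV (\<lambda>_. borel)) (\<lambda>z. \<lambda>j\<in>UNIV. z $ j)) (Pi\<^sub>E UNIV A)
       = (\<Prod>i\<in>UNIV. emeasure ?D (A i))"
      by (simp add: box)
  qed (auto cong: sets_PiM_cong)
  then show "N.indep_vars (\<lambda>_. borel) (\<lambda>j (z::real^'m). z $ j) UNIV"
    by (subst N.indep_vars_iff_distr_eq_PiM') (auto simp: law)
qed

text \<open>The coordinates of \<open>X\<close> are independent with variance \<open>\<sigma>\<^sup>2\<close>, so the inner product with \<open>v\<close>
  is a sum of independent Gaussians with variances \<open>(\<sigma> v\<^sub>j)\<^sup>2\<close>.\<close>
lemma (in prob_space) distributed_inner_isotropic_normal: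
  fixes X :: "'a \<Rightarrow> real^'m"
  assumes X[measurable]: "random_variable borel X" and law: "distr M borel X = isotropic_normal \<sigma>"
    and \<sigma>: "0 < \<sigma>" and v: "v \<noteq> 0"
  shows "distributed M lborel (\<lambda>\<omega>. v \<bullet> X \<omega>) (normal_density 0 (\<sigma> * norm v))"
proof -
  let ?N = "isotropic_normal \<sigma> :: (real^'m) measure"
  interpret N: prob_space ?N by (rule prob_space_isotropic_normal[OF \<sigma>])
  have [measurable_cong]: "sets ?N = sets borel" unfolding law[symmetric] by simp
  have norm2: "(\<Sum>j\<in>UNIV. (\<sigma> * \<bar>v $ j\<bar>)\<^sup>2) = (\<sigma> * norm v)\<^sup>2"
    by (simp add: power_mult_distrib sum_distrib_left norm_vec_def L2_set_def sum_nonneg)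
  have "distributed ?N lborel (\<lambda>z. \<Sum>j\<in>UNIV. v $ j * z $ j)
      (normal_density 0 (sqrt (\<Sum>j\<in>UNIV. (\<sigma> * \<bar>v $ j\<bar>)\<^sup>2)))"
  proof (rule N.sum_indep_centred_normal)
    show "N.indep_vars (\<lambda>_. borel) (\<lambda>j z. v $ j * z $ j) UNIV"
      using indep_isotropic_normal_nth[OF \<sigma>] by (rule N.indep_vars_compose2) auto
    show "0 < (\<Sum>j\<in>UNIV. (\<sigma> * \<bar>v $ j\<bar>)\<^sup>2)"
      unfolding norm2 using \<sigma> v by simp
  next
    fix j :: 'm assume "0 < \<sigma> * \<bar>v $ j\<bar>"
    then have vj: "v $ j \<noteq> 0" by auto
    have "distributed ?N lborel (\<lambda>z. z $ j) (normal_density 0 \<sigma>)"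
      using distr_isotropic_normal_nth[OF \<sigma>, of j] by (simp add: distributed_def cong: distr_cong)
    from N.normal_density_affine[OF this \<sigma> vj, of 0]
    show "distributed ?N lborel (\<lambda>z. v $ j * z $ j) (normal_density 0 (\<sigma> * \<bar>v $ j\<bar>))"
      by (simp add: mult.commute)
  qed (use \<sigma> in auto)
  then have "distributed ?N lborel (\<lambda>z. v \<bullet> z) (normal_density 0 (\<sigma> * norm v))"
    unfolding norm2 using \<sigma> by (simp add: inner_vec_def)
  then show ?thesis
    unfolding law[symmetric] distributed_def by (simp add: distr_distr comp_def)
qed

lemma (in prob_space) prob_normal_greater:
  assumes X: "distributed M lborel X (normal_density 0 s)" and s: "0 < s"
  shows "prob {\<omega> \<in> space M. t < X \<omega>} \<le> gauss_Q (t / s)"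
proof -
  have std: "distributed M lborel (\<lambda>\<omega>. X \<omega> / s) std_normal_density"
    using X normal_standard_normal_convert[OF s, of X 0] by simp
  then have [measurable]: "random_variable borel (\<lambda>\<omega>. X \<omega> / s)" by (simp add: distributed_def)
  have "prob {\<omega> \<in> space M. t < X \<omega>} \<le> prob {\<omega> \<in> space M. t / s \<le> X \<omega> / s}"
    using s by (intro finite_measure_mono) (auto simp: divide_right_mono)
  also have "\<dots> = measure (distr M lborel (\<lambda>\<omega>. X \<omega> / s)) {t / s..}"
    by (subst measure_distr) (auto intro!: arg_cong[where f=prob])
  also have "\<dots> = gauss_Q (t / s)"
    using std by (simp add: distributed_def gauss_Q_eq_measure)
  finally show ?thesis .
qed

section \<open>The Gaussian mechanism\<close>

definition isotropic_normal_density :: "real \<Rightarrow> real ^ 'm \<Rightarrow> real" where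
  "isotropic_normal_density \<sigma> z = (\<Prod>j\<in>UNIV. normal_density 0 \<sigma> (z $ j))"

lemma isotropic_normal_density_eq:
  assumes "0 < \<sigma>"
  shows "isotropic_normal_density \<sigma> (z :: real^'m) =
    (1 / sqrt (2 * pi * \<sigma>\<^sup>2)) ^ CARD('m) * exp (- (norm z)\<^sup>2 / (2 * \<sigma>\<^sup>2))"
proof -
  have "(\<Prod>j\<in>UNIV. exp (- (z $ j)\<^sup>2 / (2 * \<sigma>\<^sup>2))) = exp (\<Sum>j\<in>UNIV. - (z $ j)\<^sup>2 / (2 * \<sigma>\<^sup>2))"
    by (simp add: exp_sum)
  also have "(\<Sum>j\<in>UNIV. - (z $ j)\<^sup>2 / (2 * \<sigma>\<^sup>2)) = - (norm z)\<^sup>2 / (2 * \<sigma>\<^sup>2)"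
    by (simp add: norm_vec_def L2_set_def sum_nonneg sum_negf sum_divide_distrib)
  finally have *: "(\<Prod>j\<in>UNIV. exp (- (z $ j)\<^sup>2 / (2 * \<sigma>\<^sup>2))) = exp (- (norm z)\<^sup>2 / (2 * \<sigma>\<^sup>2))" .
  have "isotropic_normal_density \<sigma> z =
      (\<Prod>j\<in>(UNIV::'m set). 1 / sqrt (2 * pi * \<sigma>\<^sup>2)) * (\<Prod>j\<in>UNIV. exp (- (z $ j)\<^sup>2 / (2 * \<sigma>\<^sup>2)))"
    unfolding isotropic_normal_density_def normal_density_def
    by (subst prod.distrib[symmetric]) simp
  then show ?thesis unfolding * by (simp only: prod_constant)
qed

lemma borel_measurable_isotropic_normal_density[measurable]:
  "isotropic_normal_density \<sigma> \<in> borel_measurable borel"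
  unfolding isotropic_normal_density_def[abs_def] by measurable

lemma (in prob_space) distr_plus_isotropic_normal:
  fixes X :: "'a \<Rightarrow> real^'m"
  assumes X[measurable]: "random_variable borel X" and law: "distr M borel X = isotropic_normal \<sigma>"
    and \<sigma>: "0 < \<sigma>"
  shows "distr M borel (\<lambda>\<omega>. u + X \<omega>) = density lborel (\<lambda>z. isotropic_normal_density \<sigma> (z - u))"
proof -
  have "distr M borel (\<lambda>\<omega>. u + X \<omega>) = distr (distr M borel X) borel ((+) u)"
    by (simp add: distr_distr comp_def)
  also have "\<dots> = distr (density lborel (isotropic_normal_density \<sigma>)) borel ((+) u)"
    using \<sigma> by (simp add: law isotropic_normal_def isotropic_normal_density_def[abs_def])
  also have "\<dots> = density (distr lborel borel ((+) u)) (\<lambda>z. isotropic_normal_density \<sigma> (z - u))"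
    by (subst density_distr) auto
  finally show ?thesis by (simp add: lborel_distr_plus)
qed

text \<open>The family \<open>w\<close> is treated as one Gaussian vector with blocks indexed by \<open>I\<close>, and \<open>\<Delta>\<close> is the
  Euclidean distance of the two centres. The hypothesis \<open>tail\<close> bounds the probability of the
  half space where the density ratio exceeds \<open>exp \<epsilon>\<close>; it is stated through \<open>\<sigma> / \<Delta>\<close>, the
  quantity that \<^const>\<open>kappa\<close> bounds from below.\<close>
lemma (in prob_space) gaussian_mechanism:
  fixes w :: "'i \<Rightarrow> 'a \<Rightarrow> real^'m" and u u' :: "'i \<Rightarrow> real^'m"
  assumes I: "finite I" and ind: "indep_vars (\<lambda>_. borel) w I"
    and law: "\<And>i. i \<in> I \<Longrightarrow> distr M borel (w i) = isotropic_normal \<sigma>"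
    and \<sigma>: "0 < \<sigma>"
    and \<Delta>: "\<Delta> = sqrt (\<Sum>i\<in>I. (norm (u i - u' i))\<^sup>2)" "0 < \<Delta>"
    and tail: "gauss_Q (\<epsilon> * (\<sigma> / \<Delta>) - 1 / (2 * (\<sigma> / \<Delta>))) \<le> \<delta>"
    and A[measurable]: "A \<in> sets (PiM I (\<lambda>_. borel))"
  shows "prob {\<omega> \<in> space M. (\<lambda>i\<in>I. u i + w i \<omega>) \<in> A} \<le>
    exp \<epsilon> * prob {\<omega> \<in> space M. (\<lambda>i\<in>I. u' i + w i \<omega>) \<in> A} + \<delta>"
proof -
  let ?L = "PiM I (\<lambda>_. lborel :: (real^'m) measure)"
  let ?B = "PiM I (\<lambda>_. borel :: (real^'m) measure)"
  let ?p = "isotropic_normal_density \<sigma> :: real^'m \<Rightarrow> real"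
  define f where "f c x = (\<Prod>i\<in>I. ennreal (?p (x i - c i)))" for c x :: "'i \<Rightarrow> real^'m"
  define Y where "Y c \<omega> = (\<lambda>i\<in>I. c i + w i \<omega>)" for c \<omega>
  have ne: "I \<noteq> {}" using \<Delta> by auto
  have sq: "\<Delta>\<^sup>2 = (\<Sum>i\<in>I. (norm (u i - u' i))\<^sup>2)"
    by (simp add: \<Delta> sum_nonneg)
  have w[measurable]: "i \<in> I \<Longrightarrow> random_variable borel (w i)" for i
    using ind by (simp add: indep_vars_def2)
  have [measurable_cong]: "sets ?L = sets ?B" by (intro sets_PiM_cong) auto
  have spaceL: "space ?L = space ?B" by (simp add: space_PiM)
  have [measurable]: "f c \<in> borel_measurable ?B" for c unfolding f_def[abs_def] by measurable
  have Y[measurable]: "Y c \<in> M \<rightarrow>\<^sub>M ?B" for c unfolding Y_def by measurable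
  have lawY: "distr M ?B (Y c) = density ?L (f c)" for c
  proof -
    have "distr M ?B (Y c) = PiM I (\<lambda>i. distr M borel (\<lambda>\<omega>. c i + w i \<omega>))"
      unfolding Y_def
      by (subst indep_vars_iff_distr_eq_PiM'[OF ne, symmetric])
         (auto intro: indep_vars_compose2[OF ind])
    also have "\<dots> = PiM I (\<lambda>i. density lborel (\<lambda>z. ?p (z - c i)))"
      by (intro PiM_cong refl distr_plus_isotropic_normal) (auto simp: law \<sigma>)
    also have "\<dots> = density ?L (f c)"
      unfolding f_def
      by (intro PiM_density I sigma_finite_lborel) auto
    finally show ?thesis .
  qed
  have prob: "emeasure (density ?L (f c)) C = prob {\<omega> \<in> space M. Y c \<omega> \<in> C}"
    if "C \<in> sets ?B" for c C
    unfolding lawY[symmetric] using that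
    by (subst emeasure_distr) (auto simp: emeasure_eq_measure intro!: arg_cong[where f=prob])
  \<comment> \<open>The outputs whose likelihood ratio between the two centres exceeds \<open>exp \<epsilon>\<close>.\<close>
  define bad where "bad = {x \<in> space ?L. ennreal (exp \<epsilon>) * f u' x < f u x}"
  have bad[measurable]: "bad \<in> sets ?B" unfolding bad_def spaceL by measurable
  define S where "S \<omega> = (\<Sum>i\<in>I. (u i - u' i) \<bullet> w i \<omega>)" for \<omega>
  \<comment> \<open>Expanding the squares in the exponents shows that \<open>bad\<close> is a half space, cut out by the
    projection \<open>S\<close> of the noise on the difference of the centres.\<close>
  have bad_iff: "Y u \<omega> \<in> bad \<longleftrightarrow> \<sigma>\<^sup>2 * \<epsilon> - \<Delta>\<^sup>2 / 2 < S \<omega>" if "\<omega> \<in> space M" for \<omega>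
  proof -
    define k where "k = (1 / sqrt (2 * pi * \<sigma>\<^sup>2)) ^ CARD('m)"
    have k: "k > 0" using \<sigma> by (simp add: k_def)
    have f: "f c x = ennreal (k ^ card I * exp (- (\<Sum>i\<in>I. (norm (x i - c i))\<^sup>2) / (2 * \<sigma>\<^sup>2)))" for c x
      using \<sigma> I unfolding f_def
      by (subst prod_ennreal)
         (auto simp: isotropic_normal_density_eq k_def[symmetric] k less_imp_le prod.distrib
            sum_negf sum_divide_distrib simp flip: exp_sum)
    have Yi: "Y u \<omega> i = u i + w i \<omega>" if "i \<in> I" for i using that by (simp add: Y_def)
    have "(\<Sum>i\<in>I. (norm (Y u \<omega> i - u' i))\<^sup>2) =
      (\<Sum>i\<in>I. (norm (u i - u' i))\<^sup>2 + 2 * ((u i - u' i) \<bullet> w i \<omega>) + (norm (w i \<omega>))\<^sup>2)"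
    proof (intro sum.cong refl)
      fix i assume i: "i \<in> I"
      have "Y u \<omega> i - u' i = (u i - u' i) + w i \<omega>" using Yi[OF i] by simp
      then show "(norm (Y u \<omega> i - u' i))\<^sup>2 =
          (norm (u i - u' i))\<^sup>2 + 2 * ((u i - u' i) \<bullet> w i \<omega>) + (norm (w i \<omega>))\<^sup>2"
        by (simp only: power2_norm_eq_inner inner_add_left inner_add_right inner_commute)
    qed
    also have "\<dots> = \<Delta>\<^sup>2 + 2 * S \<omega> + (\<Sum>i\<in>I. (norm (w i \<omega>))\<^sup>2)"
      by (simp add: sum.distrib sq S_def sum_distrib_left)
    finally have e': "(\<Sum>i\<in>I. (norm (Y u \<omega> i - u' i))\<^sup>2) = \<Delta>\<^sup>2 + 2 * S \<omega> + (\<Sum>i\<in>I. (norm (w i \<omega>))\<^sup>2)" .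
    have e: "(\<Sum>i\<in>I. (norm (Y u \<omega> i - u i))\<^sup>2) = (\<Sum>i\<in>I. (norm (w i \<omega>))\<^sup>2)"
      by (intro sum.cong) (auto simp: Yi)
    have "Y u \<omega> \<in> space ?L" using that measurable_space[OF Y] by (simp add: spaceL)
    then have "Y u \<omega> \<in> bad \<longleftrightarrow> ennreal (exp \<epsilon>) * f u' (Y u \<omega>) < f u (Y u \<omega>)"
      by (simp add: bad_def)
    also have "\<dots> \<longleftrightarrow> exp \<epsilon> * (k ^ card I * exp (- (\<Delta>\<^sup>2 + 2 * S \<omega> + (\<Sum>i\<in>I. (norm (w i \<omega>))\<^sup>2)) / (2 * \<sigma>\<^sup>2)))
        < k ^ card I * exp (- (\<Sum>i\<in>I. (norm (w i \<omega>))\<^sup>2) / (2 * \<sigma>\<^sup>2))"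
      unfolding f e e' using k by (subst ennreal_mult[symmetric]) (auto simp: ennreal_less_iff)
    also have "\<dots> \<longleftrightarrow> exp \<epsilon> * exp (- (\<Delta>\<^sup>2 + 2 * S \<omega> + (\<Sum>i\<in>I. (norm (w i \<omega>))\<^sup>2)) / (2 * \<sigma>\<^sup>2))
        < exp (- (\<Sum>i\<in>I. (norm (w i \<omega>))\<^sup>2) / (2 * \<sigma>\<^sup>2))"
      using k by (simp add: mult.left_commute)
    also have "\<dots> \<longleftrightarrow> \<epsilon> + - (\<Delta>\<^sup>2 + 2 * S \<omega> + (\<Sum>i\<in>I. (norm (w i \<omega>))\<^sup>2)) / (2 * \<sigma>\<^sup>2)
        < - (\<Sum>i\<in>I. (norm (w i \<omega>))\<^sup>2) / (2 * \<sigma>\<^sup>2)"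
      by (simp only: exp_less_cancel_iff flip: exp_add)
    also have "\<dots> \<longleftrightarrow> \<epsilon> < (\<Delta>\<^sup>2 + 2 * S \<omega>) / (2 * \<sigma>\<^sup>2)"
      by (simp add: add_divide_distrib diff_divide_distrib) linarith
    also have "\<dots> \<longleftrightarrow> \<sigma>\<^sup>2 * \<epsilon> - \<Delta>\<^sup>2 / 2 < S \<omega>"
      using \<sigma> by (simp add: pos_less_divide_eq algebra_simps) linarith
    finally show ?thesis .
  qed
  have "distributed M lborel S (normal_density 0 (sqrt (\<Sum>i\<in>I. (\<sigma> * norm (u i - u' i))\<^sup>2)))"
    unfolding S_def
  proof (rule sum_indep_centred_normal[OF I])
    show "indep_vars (\<lambda>_. borel) (\<lambda>i \<omega>. (u i - u' i) \<bullet> w i \<omega>) I"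
      by (rule indep_vars_compose2[OF ind]) auto
    show "0 < (\<Sum>i\<in>I. (\<sigma> * norm (u i - u' i))\<^sup>2)"
      using \<sigma> \<Delta>(2) by (simp add: power_mult_distrib flip: sum_distrib_left sq)
  qed (use \<sigma> law in \<open>auto intro!: distributed_inner_isotropic_normal\<close>)
  moreover have "sqrt (\<Sum>i\<in>I. (\<sigma> * norm (u i - u' i))\<^sup>2) = \<sigma> * \<Delta>"
    using \<sigma> \<Delta>(2) by (simp add: power_mult_distrib real_sqrt_mult flip: sum_distrib_left sq)
  ultimately have "distributed M lborel S (normal_density 0 (\<sigma> * \<Delta>))" by simp
  then have "prob {\<omega> \<in> space M. \<sigma>\<^sup>2 * \<epsilon> - \<Delta>\<^sup>2 / 2 < S \<omega>} \<le> gauss_Q ((\<sigma>\<^sup>2 * \<epsilon> - \<Delta>\<^sup>2 / 2) / (\<sigma> * \<Delta>))"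
    using \<sigma> \<Delta>(2) by (intro prob_normal_greater) auto
  also have "(\<sigma>\<^sup>2 * \<epsilon> - \<Delta>\<^sup>2 / 2) / (\<sigma> * \<Delta>) = \<epsilon> * (\<sigma> / \<Delta>) - 1 / (2 * (\<sigma> / \<Delta>))"
    using \<sigma> \<Delta>(2) by (simp add: field_simps power2_eq_square)
  also note tail
  also have "{\<omega> \<in> space M. \<sigma>\<^sup>2 * \<epsilon> - \<Delta>\<^sup>2 / 2 < S \<omega>} = {\<omega> \<in> space M. Y u \<omega> \<in> bad}"
    using bad_iff by auto
  finally have small: "prob {\<omega> \<in> space M. Y u \<omega> \<in> bad} \<le> \<delta>" .
  have "emeasure (density ?L (f u)) A \<le>
      ennreal (exp \<epsilon>) * emeasure (density ?L (f u')) A + emeasure (density ?L (f u)) bad"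
    unfolding bad_def by (rule density_measure_le_scaled_plus_tail) measurable
  then have "ennreal (prob {\<omega> \<in> space M. Y u \<omega> \<in> A}) \<le>
      ennreal (exp \<epsilon> * prob {\<omega> \<in> space M. Y u' \<omega> \<in> A} + prob {\<omega> \<in> space M. Y u \<omega> \<in> bad})"
    by (simp add: prob[OF A] prob[OF bad] ennreal_mult ennreal_plus)
  then have "prob {\<omega> \<in> space M. Y u \<omega> \<in> A} \<le>
      exp \<epsilon> * prob {\<omega> \<in> space M. Y u' \<omega> \<in> A} + prob {\<omega> \<in> space M. Y u \<omega> \<in> bad}"
    by (subst (asm) ennreal_le_iff) auto
  then show ?thesis using small unfolding Y_def by linarith
qed

section \<open>Sensitivity of the partial derivative\<close>

text \<open>For each pair of distinct points the difference quotient is a lower bound of all admissible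
  constants, hence at most their infimum; so the infimum is admissible and is the least one.\<close>
lemma lipschitz_on_lipschitz_constant:
  fixes f :: "'a::metric_space \<Rightarrow> 'b::metric_space"
  assumes "L-lipschitz_on X f"
  shows "(lipschitz_constant X f)-lipschitz_on X f"
proof -
  let ?S = "{L. L-lipschitz_on X f}"
  define I where "I = Inf ?S"
  have ne: "?S \<noteq> {}" using assms by auto
  have bdd: "bdd_below ?S" by (auto intro!: bdd_belowI[of _ 0] simp: lipschitz_on_def)
  have "I-lipschitz_on X f"
  proof (rule lipschitz_onI)
    show "0 \<le> I" unfolding I_def using ne by (intro cInf_greatest) (auto simp: lipschitz_on_def)
    fix x y assume xy: "x \<in> X" "y \<in> X"
    show "dist (f x) (f y) \<le> I * dist x y"
    proof (cases "x = y")
      case False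
      then have "dist (f x) (f y) / dist x y \<le> I"
        unfolding I_def using ne xy
        by (intro cInf_greatest) (auto simp: lipschitz_on_def pos_divide_le_eq)
      then show ?thesis using False by (simp add: pos_divide_le_eq)
    qed simp
  qed
  then show ?thesis
    unfolding lipschitz_constant_def I_def
    by (rule LeastI2_order) (auto intro!: cInf_lower bdd)
qed

lemma C1_lipschitz_on_compact_convex:
  fixes F :: "'a::real_normed_vector \<Rightarrow> 'b::real_normed_vector"
  assumes X: "compact X" "convex X"
    and F: "\<And>x. (F has_derivative blinfun_apply (F' x)) (at x)"
    and cont: "continuous_on UNIV F'"
  obtains C where "C-lipschitz_on X F"
proof -
  have "bounded (F' ` X)"
    using X continuous_on_subset[OF cont] by (intro compact_imp_bounded compact_continuous_image) auto
  then obtain C where C: "\<And>x. x \<in> X \<Longrightarrow> norm (F' x) \<le> C" by (auto simp: bounded_iff)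
  have "\<bar>C\<bar>-lipschitz_on X F"
  proof (rule bounded_derivative_imp_lipschitz[OF _ X(2)])
    fix x assume x: "x \<in> X"
    show "(F has_derivative blinfun_apply (F' x)) (at x within X)"
      using F by (rule has_derivative_at_withinI)
    show "onorm (blinfun_apply (F' x)) \<le> \<bar>C\<bar>"
      using C[OF x] by (simp add: norm_blinfun.rep_eq)
  qed simp
  then show thesis by (rule that)
qed

text \<open>Identifying the coordinates of the partial derivative needs differentiability: otherwise
  \<^const>\<open>vector_derivative\<close> is an arbitrary vector.\<close>
lemma partial_derivative_nth:
  fixes g :: "real^'n \<Rightarrow> real^'m"
  assumes "\<And>j. ((\<lambda>x. g x $ j) has_derivative g' j) (at x)"
  shows "partial_derivative g i x $ j = g' j (axis i 1)"
proof -
  have 1: "((\<lambda>t. x + t *\<^sub>R axis i 1) has_vector_derivative axis i 1) (at 0)" for i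
    by (auto intro!: derivative_eq_intros)
  have "((\<lambda>t. g (x + t *\<^sub>R axis i 1) $ j) has_vector_derivative g' j (axis i 1)) (at 0)" for j
    using has_derivative_compose[OF 1[of i, unfolded has_vector_derivative_def], of "\<lambda>x. g x $ j" "g' j"]
      assms[of j] has_derivative_bounded_linear[OF assms[of j]]
    by (simp add: has_vector_derivative_def linear_simps)
  then have "((\<lambda>t. g (x + t *\<^sub>R axis i 1)) has_vector_derivative (\<chi> j. g' j (axis i 1))) (at 0)"
    unfolding has_vector_derivative_def
    by (subst has_derivative_componentwise_within) (auto simp: Basis_vec_def inner_axis)
  then show ?thesis
    unfolding partial_derivative_def by (simp add: vector_derivative_at)
qed

text \<open>In each component the partial derivative is the value of the total derivative at a unit vector,
  so it inherits the Lipschitz constant of the total derivative. Summing over the components loses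
  sharpness, which does not matter: only the existence of some constant is claimed.\<close>
lemma partial_derivative_lipschitz:
  fixes g :: "real^'n \<Rightarrow> real^'m"
  assumes X: "compact X" "convex X" and g: "\<And>j. twice_cont_differentiable (\<lambda>x. g x $ j)"
  obtains L where "L-lipschitz_on X (partial_derivative g i)"
proof -
  have "\<exists>C (g' :: real^'n \<Rightarrow> _ \<Rightarrow>\<^sub>L real). C-lipschitz_on X g' \<and>
    (\<forall>x. ((\<lambda>x. g x $ j) has_derivative blinfun_apply (g' x)) (at x))" for j
    using g[of j] unfolding twice_cont_differentiable_def
    by (metis C1_lipschitz_on_compact_convex[OF X])
  then obtain C and g' :: "'m \<Rightarrow> real^'n \<Rightarrow> (real^'n) \<Rightarrow>\<^sub>L real" where
    lip: "\<And>j. (C j)-lipschitz_on X (g' j)" and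
    der: "\<And>j x. ((\<lambda>x. g x $ j) has_derivative blinfun_apply (g' j x)) (at x)"
    by metis
  have "(\<Sum>j\<in>UNIV. C j)-lipschitz_on X (partial_derivative g i)"
  proof (rule lipschitz_onI)
    show "0 \<le> (\<Sum>j\<in>UNIV. C j)" using lip by (intro sum_nonneg) (auto simp: lipschitz_on_def)
    fix x y assume xy: "x \<in> X" "y \<in> X"
    have "dist (partial_derivative g i x) (partial_derivative g i y) \<le>
      (\<Sum>j\<in>UNIV. \<bar>(partial_derivative g i x - partial_derivative g i y) $ j\<bar>)"
      unfolding dist_norm by (rule norm_le_l1_cart)
    also have "\<dots> \<le> (\<Sum>j\<in>UNIV. C j * dist x y)"
    proof (rule sum_mono)
      fix j
      have "\<bar>(partial_derivative g i x - partial_derivative g i y) $ j\<bar> =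
          norm (blinfun_apply (g' j x - g' j y) (axis i 1))"
        by (simp add: partial_derivative_nth[OF der] blinfun.diff_left)
      also have "\<dots> \<le> norm (g' j x - g' j y) * norm (axis i (1::real))"
        by (rule norm_blinfun)
      also have "\<dots> \<le> C j * dist x y"
        using lipschitz_onD[OF lip xy] by (simp add: dist_norm)
      finally show "\<bar>(partial_derivative g i x - partial_derivative g i y) $ j\<bar> \<le> C j * dist x y" .
    qed
    finally show "dist (partial_derivative g i x) (partial_derivative g i y) \<le> (\<Sum>j\<in>UNIV. C j) * dist x y"
      by (simp add: sum_distrib_right)
  qed
  then show thesis by (rule that)
qed

text \<open>Samples of adjacent signals differ by a multiple of one axis vector, so the Lipschitz estimate at
  each time sees only the differing component, and partial sums of its squared differences are
  bounded by the full \<open>\<ell>\<^sup>2\<close> series.\<close>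
lemma Adj_lipschitz_sensitivity:
  fixes f :: "real^'n \<Rightarrow> 'b::real_normed_vector"
  assumes lip: "L-lipschitz_on X f" and x: "x \<in> signals X" "x' \<in> signals X"
    and adj: "Adj b x x'" and b: "\<And>l. b l \<le> B"
  shows "sqrt (\<Sum>k\<in>{..N}. (norm (f (x k) - f (x' k)))\<^sup>2) \<le> L * B"
proof -
  obtain l where sm: "summable (\<lambda>k. \<bar>x k $ l - x' k $ l\<bar>\<^sup>2)"
    and le: "sqrt (\<Sum>k. \<bar>x k $ l - x' k $ l\<bar>\<^sup>2) \<le> b l"
    and eq: "\<And>j k. j \<noteq> l \<Longrightarrow> x k $ j = x' k $ j"
    using adj by (auto simp: Adj_def)
  have L: "0 \<le> L" using lip by (simp add: lipschitz_on_def)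
  have nrm: "norm (x k - x' k) = \<bar>x k $ l - x' k $ l\<bar>" for k
  proof -
    have "x k - x' k = (x k $ l - x' k $ l) *\<^sub>R axis l 1"
      using eq by (auto simp: vec_eq_iff axis_def)
    then show ?thesis by (metis norm_scaleR norm_axis_1 mult.right_neutral)
  qed
  have "(\<Sum>k\<in>{..N}. (norm (f (x k) - f (x' k)))\<^sup>2) \<le> (\<Sum>k\<in>{..N}. L\<^sup>2 * \<bar>x k $ l - x' k $ l\<bar>\<^sup>2)"
  proof (rule sum_mono)
    fix k
    have "norm (f (x k) - f (x' k)) \<le> L * \<bar>x k $ l - x' k $ l\<bar>"
      using lipschitz_onD[OF lip, of "x k" "x' k"] x by (simp add: dist_norm nrm signals_def)
    then show "(norm (f (x k) - f (x' k)))\<^sup>2 \<le> L\<^sup>2 * \<bar>x k $ l - x' k $ l\<bar>\<^sup>2"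
      by (metis norm_ge_zero power_mono power_mult_distrib)
  qed
  also have "\<dots> \<le> L\<^sup>2 * (\<Sum>k. \<bar>x k $ l - x' k $ l\<bar>\<^sup>2)"
    unfolding sum_distrib_left[symmetric]
    by (intro mult_left_mono sum_le_suminf sm) auto
  finally have "sqrt (\<Sum>k\<in>{..N}. (norm (f (x k) - f (x' k)))\<^sup>2) \<le>
      sqrt (L\<^sup>2 * (\<Sum>k. \<bar>x k $ l - x' k $ l\<bar>\<^sup>2))"
    by (rule real_sqrt_le_mono)
  also have "\<dots> \<le> L * b l"
    using L le by (simp add: real_sqrt_mult mult_left_mono)
  also have "\<dots> \<le> L * B" using L b by (rule mult_left_mono[rotated])
  finally show ?thesis .
qed

section \<open>Privacy of the perturbed partial derivative\<close>

theorem theorem2: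
  fixes X :: "(real ^ 'n) set"
    and g :: "real ^ 'n \<Rightarrow> real ^ 'm"
    and b :: "'n \<Rightarrow> real"
    and B \<epsilon> \<delta> \<sigma> :: real
    and i :: 'n
    and P :: "'w measure"
    and w :: "nat \<Rightarrow> 'w \<Rightarrow> real ^ 'm"
  assumes "X \<noteq> {}" and "compact X" and "convex X"
    and "\<And>j. convex_on UNIV (\<lambda>x. g x $ j)"
    and "\<And>j. twice_cont_differentiable (\<lambda>x. g x $ j)"
    and "\<And>l. 0 \<le> b l"
    and "B = Max (range b)"
    and "0 < \<epsilon>" and "0 < \<delta>" and "\<delta> < 1"
    and "prob_space P"
    and "prob_space.indep_vars P (\<lambda>_. borel) w UNIV"
    and "\<And>k. distr P borel (w k) = isotropic_normal \<sigma>"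
    and "\<sigma> \<ge> kappa \<delta> \<epsilon> * lipschitz_constant X (partial_derivative g i) * B"
  shows "diff_private P (signals X) (Adj b) \<epsilon> \<delta>
           (\<lambda>x \<omega> k. partial_derivative g i (x k) + w k \<omega>)"
proof -
  interpret prob_space P by fact
  let ?f = "partial_derivative g i"
  define K where "K = lipschitz_constant X ?f"
  obtain L where "L-lipschitz_on X ?f"
    using partial_derivative_lipschitz assms(2,3,5) by blast
  then have lip: "K-lipschitz_on X ?f"
    unfolding K_def by (rule lipschitz_on_lipschitz_constant)
  have bB: "b l \<le> B" for l by (simp add: assms(7))
  have w[measurable]: "random_variable borel (w k)" for k
    using assms(12) by (simp add: indep_vars_def2)
  show ?thesis
    unfolding diff_private_def mechanism_def
  proof (intro conjI ballI allI impI)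
    fix x x' S and k :: nat
    assume x: "x \<in> signals X" "x' \<in> signals X" and adj: "Adj b x x'"
      and S: "S \<in> sets (PiM {..k} (\<lambda>_. borel :: (real^'m) measure))"
    let ?p = "\<lambda>x. prob {\<omega> \<in> space P. (\<lambda>j\<in>{..k}. ?f (x j) + w j \<omega>) \<in> S}"
    define \<Delta> where "\<Delta> = sqrt (\<Sum>j\<in>{..k}. (norm (?f (x j) - ?f (x' j)))\<^sup>2)"
    have "\<Delta> \<le> K * B"
      unfolding \<Delta>_def using lip x adj bB by (rule Adj_lipschitz_sensitivity)
    then have "kappa \<delta> \<epsilon> * \<Delta> \<le> kappa \<delta> \<epsilon> * (K * B)"
      using kappa_pos[OF assms(8)] by (simp add: mult_left_mono)
    then have \<sigma>: "kappa \<delta> \<epsilon> * \<Delta> \<le> \<sigma>"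
      using assms(14) by (simp add: K_def mult.assoc)
    have "0 \<le> \<Delta>" by (simp add: \<Delta>_def sum_nonneg)
    then consider "\<Delta> = 0" | "0 < \<Delta>" by linarith
    then show "?p x \<le> exp \<epsilon> * ?p x' + \<delta>"
    proof cases
      case 1
      then have "?f (x j) = ?f (x' j)" if "j \<le> k" for j
        using that by (simp add: \<Delta>_def sum_nonneg_eq_0_iff)
      then have "(\<lambda>j\<in>{..k}. ?f (x j) + w j \<omega>) = (\<lambda>j\<in>{..k}. ?f (x' j) + w j \<omega>)" for \<omega>
        by (intro restrict_ext) simp
      then have "?p x = 1 * ?p x'" by simp
      also have "\<dots> \<le> exp \<epsilon> * ?p x'" using assms(8) by (intro mult_right_mono) auto
      finally show ?thesis using assms(9) by linarith
    next
      case 2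
      have \<sigma>0: "0 < \<sigma>" using mult_pos_pos[OF kappa_pos[OF assms(8), of \<delta>] 2] \<sigma> by linarith
      have "gauss_K \<delta> \<le> \<epsilon> * (\<sigma> / \<Delta>) - 1 / (2 * (\<sigma> / \<Delta>))"
        using \<sigma> 2 by (intro kappa_le_imp_gauss_K_le assms(8)) (simp add: pos_le_divide_eq)
      then have "gauss_Q (\<epsilon> * (\<sigma> / \<Delta>) - 1 / (2 * (\<sigma> / \<Delta>))) \<le> \<delta>"
        using gauss_Q_antimono gauss_Q_gauss_K[OF assms(9,10)] by metis
      then show ?thesis
        using 2 \<sigma>0 S assms(13)
        by (intro gaussian_mechanism[OF _ _ _ _ \<Delta>_def] indep_vars_subset[OF assms(12)]) auto
    qed
  qed (use assms in auto)
qed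

end
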